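(* Let $A$ be a commutative unital ring, $M$ an $A$-module, and $M=N\oplus H$ a decomposition of $M$ as a direct sum of two submodules. The following statements are equivalent: (a) $N\subseteq M$ is a distributive submodule. (b) $\operatorname{Supp}(N)\cap\operatorname{Supp}(H)=\varnothing$. (c) $H\subseteq M$ is a distributive submodule.
   Context: A submodule $N\subseteq M$ is distributive if $(Y_1+Y_2)\cap N=(Y_1\cap N)+(Y_2\cap N)$ for all submodules $Y_1,Y_2\subseteq M$. $\operatorname{Supp}(N)$ is the set of prime ideals $\mathfrak{p}$ of $A$ with $N_{\mathfrak{p}}\neq 0$. *)

theory Defs
  imports "HOL-Algebra.Module" "HOL-Algebra.Ideal"
begin

definition distributive_submodule ::
    "('a, 'r) ring_scheme \<Rightarrow> ('a, 'b, 'm) module_scheme \<Rightarrow> 'b set \<Rightarrow> bool" where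
  "distributive_submodule R M N \<longleftrightarrow>
     submodule N R M \<and>
     (\<forall>Y1 Y2. submodule Y1 R M \<longrightarrow> submodule Y2 R M \<longrightarrow>
        (Y1 <+>\<^bsub>M\<^esub> Y2) \<inter> N = (Y1 \<inter> N) <+>\<^bsub>M\<^esub> (Y2 \<inter> N))"

definition internal_direct_sum ::
    "('a, 'r) ring_scheme \<Rightarrow> ('a, 'b, 'm) module_scheme \<Rightarrow> 'b set \<Rightarrow> 'b set \<Rightarrow> bool" where
  "internal_direct_sum R M N H \<longleftrightarrow>
     submodule N R M \<and> submodule H R M \<and>
     N <+>\<^bsub>M\<^esub> H = carrier M \<and> N \<inter> H = {\<zero>\<^bsub>M\<^esub>}"

text \<open>The pair \<open>(m, s)\<close> stands for the fraction \<open>m/s\<close>; the factor \<open>u\<close> is needed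
  because \<open>S\<close> may contain elements that annihilate nonzero elements of \<open>M\<close>.\<close>

definition fraction_rel ::
    "('a, 'r) ring_scheme \<Rightarrow> ('a, 'b, 'm) module_scheme \<Rightarrow> 'a set \<Rightarrow> (('b \<times> 'a) \<times> ('b \<times> 'a)) set"
  where
  "fraction_rel R M S =
     {((m, s), (n, t)). m \<in> carrier M \<and> s \<in> S \<and> n \<in> carrier M \<and> t \<in> S \<and>
        (\<exists>u\<in>S. u \<odot>\<^bsub>M\<^esub> (t \<odot>\<^bsub>M\<^esub> m) = u \<odot>\<^bsub>M\<^esub> (s \<odot>\<^bsub>M\<^esub> n))}"

text \<open>The localization of \<open>M\<close> at \<open>S\<close>, as an \<open>R\<close>-module by restriction of scalars.
  The record type of modules extends that of rings; the fields \<open>mult\<close> and \<open>one\<close> play no role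
  for a module.\<close>

definition localization ::
    "('a, 'r) ring_scheme \<Rightarrow> ('a, 'b, 'm) module_scheme \<Rightarrow> 'a set \<Rightarrow> ('a, ('b \<times> 'a) set) module"
  where
  "localization R M S =
     \<lparr>carrier = (carrier M \<times> S) // fraction_rel R M S,
      mult = undefined,
      one = undefined,
      zero = fraction_rel R M S `` {(\<zero>\<^bsub>M\<^esub>, \<one>\<^bsub>R\<^esub>)},
      add = (\<lambda>C D. \<Union>{fraction_rel R M S `` {(t \<odot>\<^bsub>M\<^esub> m \<oplus>\<^bsub>M\<^esub> s \<odot>\<^bsub>M\<^esub> n, s \<otimes>\<^bsub>R\<^esub> t)} | m s n t.
                         (m, s) \<in> C \<and> (n, t) \<in> D}),
      smult = (\<lambda>a C. \<Union>{fraction_rel R M S `` {(a \<odot>\<^bsub>M\<^esub> m, s)} | m s. (m, s) \<in> C})\<rparr>"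

definition Supp ::
    "('a, 'r) ring_scheme \<Rightarrow> ('a, 'b, 'm) module_scheme \<Rightarrow> 'a set set" where
  "Supp R M =
     {P. primeideal P R \<and>
         carrier (localization R M (carrier R - P)) \<noteq> {\<zero>\<^bsub>localization R M (carrier R - P)\<^esub>}}"

end

theory Submission
  imports "HOL-Algebra.Ring_Divisibility" Defs
begin

text \<open>
  All three conditions say that \<open>N\<close> and \<open>H\<close> can be separated by scalars: for all \<open>n \<in> N\<close> and
  \<open>h \<in> H\<close> there is a scalar \<open>e\<close> with \<open>e n = n\<close> and \<open>e h = 0\<close>, that is,
  \<open>Ann n + Ann h\<close> is the whole ring. Since (b) is symmetric in \<open>N\<close> and \<open>H\<close>, it is
  enough to compare this condition with (a) and with (b).

  If \<open>N\<close> is distributive, intersect \<open>R (n + h) + R h\<close>, which contains \<open>n\<close>, with \<open>N\<close>. Since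
  \<open>R h\<close> meets \<open>N\<close> only in \<open>0\<close>, distributivity makes \<open>n\<close> a multiple \<open>e (n + h)\<close>, and comparing
  components gives \<open>e n = n\<close> and \<open>e h = 0\<close>. Conversely, with such scalars every submodule contains
  the \<open>N\<close>-component of each of its elements \<open>n + h\<close>, because this component is \<open>e (n + h)\<close>;
  hence the projection to \<open>N\<close> maps \<open>Y\<^sub>1 + Y\<^sub>2\<close> into \<open>(Y\<^sub>1 \<inter> N) + (Y\<^sub>2 \<inter> N)\<close>, and \<open>N\<close> is distributive.

  A prime \<open>P\<close> is in the support of a module if and only if it contains the annihilator of some
  element (\<open>mem_Supp_iff\<close>). So the supports are disjoint if and only if no prime contains some
  \<open>Ann n + Ann h\<close>, and as every proper ideal lies in a prime, this says that these sums are all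
  the whole ring.
\<close>

section \<open>Proper ideals and prime ideals\<close>

text \<open>Zorn's lemma gives an ideal that is maximal among the ideals above \<open>I\<close> without \<open>\<one>\<close>; it is a
  maximal ideal of the ring, hence prime.\<close>

lemma (in cring) proper_ideal_imp_prime_above:
  assumes I: "ideal I R" and proper: "\<one> \<notin> I"
  obtains P where "primeideal P R" "I \<subseteq> P"
proof -
  define A where "A = {J. ideal J R \<and> I \<subseteq> J \<and> \<one> \<notin> J}"
  have "\<exists>P\<in>A. \<forall>J\<in>A. P \<subseteq> J \<longrightarrow> J = P"
  proof (rule subset_Zorn_nonempty)
    show "A \<noteq> {}"
      using I proper by (auto simp: A_def)
    fix C assume C: "C \<noteq> {}" "subset.chain A C"
    have "subset.chain {J. ideal J R} C"
      using C(2) unfolding A_def subset.chain_def by auto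
    then have "ideal (\<Union>C) R"
      using chain_Union_is_ideal[of C] C(1) by simp
    then show "\<Union>C \<in> A"
      using C unfolding A_def subset.chain_def by auto
  qed
  then obtain P where P: "ideal P R" "I \<subseteq> P" "\<one> \<notin> P"
    and max: "\<And>J. J \<in> A \<Longrightarrow> P \<subseteq> J \<Longrightarrow> J = P"
    unfolding A_def by auto
  have "maximalideal P R"
  proof (rule maximalidealI)
    show "carrier R \<noteq> P"
      using P(3) by auto
    fix J assume J: "ideal J R" "P \<subseteq> J"
    show "J = P \<or> J = carrier R"
      using max[of J] ideal.one_imp_carrier[OF J(1)] J P(2) unfolding A_def by blast
  qed (rule P(1))
  then show ?thesis
    using that P(2) maximalideal_prime by blast
qed

section \<open>Supports and annihilators\<close>

definition annihilator ::
    "('a, 'r) ring_scheme \<Rightarrow> ('a, 'b, 'm) module_scheme \<Rightarrow> 'b \<Rightarrow> 'a set" where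
  "annihilator R M x = {a \<in> carrier R. a \<odot>\<^bsub>M\<^esub> x = \<zero>\<^bsub>M\<^esub>}"

lemma annihilator_restrict [simp]:
  "annihilator R (M\<lparr>carrier := N\<rparr>) x = annihilator R M x"
  by (simp add: annihilator_def)

lemma (in module) annihilator_ideal:
  assumes x: "x \<in> carrier M"
  shows "ideal (annihilator R M x) R"
proof (rule idealI[OF R.ring_axioms])
  show "subgroup (annihilator R M x) (add_monoid R)"
  proof (rule R.add.subgroupI)
    show "annihilator R M x \<noteq> {}"
      using x by (auto simp: annihilator_def intro!: exI[of _ \<zero>])
  qed (use x in \<open>auto simp: annihilator_def smult_l_distr smult_l_minus simp flip: a_inv_def\<close>)
  fix a b assume a: "a \<in> annihilator R M x" and b: "b \<in> carrier R"
  show "b \<otimes> a \<in> annihilator R M x"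
    using a b x by (simp add: annihilator_def smult_assoc1)
  then show "a \<otimes> b \<in> annihilator R M x"
    using a b by (simp add: annihilator_def R.m_comm)
qed

text \<open>The denominators at \<open>P\<close> are the scalars outside \<open>P\<close>, so \<open>annihilator R M m \<subseteq> P\<close> says that
  no denominator kills \<open>m\<close>, which means that \<open>m/1\<close> is not zero. If on the other hand every element
  is killed by a denominator, then any two fractions agree: the product of a denominator
  killing the one numerator and a denominator killing the other is a common witness.\<close>

lemma (in module) mem_Supp_iff:
  "P \<in> Supp R M \<longleftrightarrow> primeideal P R \<and> (\<exists>m\<in>carrier M. annihilator R M m \<subseteq> P)"
proof (cases "primeideal P R")
  case True
  interpret P: primeideal P R by (rule True)
  define S where "S = carrier R - P"
  define E where "E = fraction_rel R M S"
  have S_carrier: "s \<in> carrier R" if "s \<in> S" for s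
    using that by (simp add: S_def)
  have one: "\<one> \<in> S"
    using P.I_notcarr P.one_imp_carrier by (auto simp: S_def)
  have mult: "s \<otimes> t \<in> S" if "s \<in> S" "t \<in> S" for s t
    using that P.I_prime by (auto simp: S_def)
  have E_iff: "((m, s), (n, t)) \<in> E \<longleftrightarrow>
      m \<in> carrier M \<and> s \<in> S \<and> n \<in> carrier M \<and> t \<in> S \<and>
      (\<exists>u\<in>S. u \<odot>\<^bsub>M\<^esub> (t \<odot>\<^bsub>M\<^esub> m) = u \<odot>\<^bsub>M\<^esub> (s \<odot>\<^bsub>M\<^esub> n))" for m s n t
    by (simp add: E_def fraction_rel_def)
  have "(carrier M \<times> S) // E = {E `` {(\<zero>\<^bsub>M\<^esub>, \<one>)}} \<longleftrightarrow>
      (\<forall>m\<in>carrier M. \<exists>u\<in>S. u \<odot>\<^bsub>M\<^esub> m = \<zero>\<^bsub>M\<^esub>)"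
  proof
    assume trivial: "(carrier M \<times> S) // E = {E `` {(\<zero>\<^bsub>M\<^esub>, \<one>)}}"
    show "\<forall>m\<in>carrier M. \<exists>u\<in>S. u \<odot>\<^bsub>M\<^esub> m = \<zero>\<^bsub>M\<^esub>"
    proof
      fix m assume m: "m \<in> carrier M"
      have "E `` {(m, \<one>)} \<in> (carrier M \<times> S) // E"
        using m one by (intro quotientI) auto
      then have cls: "E `` {(m, \<one>)} = E `` {(\<zero>\<^bsub>M\<^esub>, \<one>)}"
        unfolding trivial by (rule singletonD)
      have "((m, \<one>), (m, \<one>)) \<in> E"
        using m one by (auto simp: E_iff)
      then have "((\<zero>\<^bsub>M\<^esub>, \<one>), (m, \<one>)) \<in> E"
        using cls by (simp only: flip: Image_singleton_iff)
      then show "\<exists>u\<in>S. u \<odot>\<^bsub>M\<^esub> m = \<zero>\<^bsub>M\<^esub>"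
        using m S_carrier by (auto simp: E_iff)
    qed
  next
    assume killed: "\<forall>m\<in>carrier M. \<exists>u\<in>S. u \<odot>\<^bsub>M\<^esub> m = \<zero>\<^bsub>M\<^esub>"
    have related: "((m, s), (n, t)) \<in> E"
      if m: "m \<in> carrier M" and s: "s \<in> S" and n: "n \<in> carrier M" and t: "t \<in> S" for m s n t
    proof -
      obtain u v where u: "u \<in> S" "u \<odot>\<^bsub>M\<^esub> m = \<zero>\<^bsub>M\<^esub>" and v: "v \<in> S" "v \<odot>\<^bsub>M\<^esub> n = \<zero>\<^bsub>M\<^esub>"
        using killed m n by blast
      note c = u(1)[THEN S_carrier] v(1)[THEN S_carrier] s[THEN S_carrier] t[THEN S_carrier]
      have "(u \<otimes> v) \<odot>\<^bsub>M\<^esub> (t \<odot>\<^bsub>M\<^esub> m) = (v \<otimes> t \<otimes> u) \<odot>\<^bsub>M\<^esub> m"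
        using c m by (simp add: R.m_ac flip: smult_assoc1)
      also have "\<dots> = \<zero>\<^bsub>M\<^esub>"
        using c m u by (simp add: smult_assoc1)
      finally have 1: "(u \<otimes> v) \<odot>\<^bsub>M\<^esub> (t \<odot>\<^bsub>M\<^esub> m) = \<zero>\<^bsub>M\<^esub>" .
      have "(u \<otimes> v) \<odot>\<^bsub>M\<^esub> (s \<odot>\<^bsub>M\<^esub> n) = (u \<otimes> s \<otimes> v) \<odot>\<^bsub>M\<^esub> n"
        using c n by (simp add: R.m_ac flip: smult_assoc1)
      also have "\<dots> = \<zero>\<^bsub>M\<^esub>"
        using c n v by (simp add: smult_assoc1)
      finally have "\<exists>w\<in>S. w \<odot>\<^bsub>M\<^esub> (t \<odot>\<^bsub>M\<^esub> m) = w \<odot>\<^bsub>M\<^esub> (s \<odot>\<^bsub>M\<^esub> n)"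
        using 1 mult[OF u(1) v(1)] by (intro bexI[of _ "u \<otimes> v"]) simp
      then show ?thesis
        using m s n t by (simp add: E_iff)
    qed
    have cls: "E `` {(m, s)} = carrier M \<times> S" if "m \<in> carrier M" "s \<in> S" for m s
      using related that by (auto simp: E_iff)
    then have "(carrier M \<times> S) // E = (\<Union>p\<in>carrier M \<times> S. {carrier M \<times> S})"
      unfolding quotient_def by (intro SUP_cong refl) auto
    also have "\<dots> = {carrier M \<times> S}"
      using one by (intro UN_constant_eq[of "(\<zero>\<^bsub>M\<^esub>, \<one>)"]) auto
    also have "\<dots> = {E `` {(\<zero>\<^bsub>M\<^esub>, \<one>)}}"
      using cls one by simp
    finally show "(carrier M \<times> S) // E = {E `` {(\<zero>\<^bsub>M\<^esub>, \<one>)}}" .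
  qed
  moreover have "P \<in> Supp R M \<longleftrightarrow> (carrier M \<times> S) // E \<noteq> {E `` {(\<zero>\<^bsub>M\<^esub>, \<one>)}}"
    using True by (simp add: Supp_def localization_def E_def S_def)
  moreover have "annihilator R M m \<subseteq> P \<longleftrightarrow> \<not> (\<exists>u\<in>S. u \<odot>\<^bsub>M\<^esub> m = \<zero>\<^bsub>M\<^esub>)" for m
    unfolding annihilator_def S_def by blast
  ultimately show ?thesis
    using True by simp
next
  case False
  then show ?thesis
    unfolding Supp_def by blast
qed

section \<open>Separation by scalars\<close>

definition separated_by_scalars ::
    "('a, 'r) ring_scheme \<Rightarrow> ('a, 'b, 'm) module_scheme \<Rightarrow> 'b set \<Rightarrow> 'b set \<Rightarrow> bool" where
  "separated_by_scalars R M N H \<longleftrightarrow>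
     (\<forall>n\<in>N. \<forall>h\<in>H. \<exists>e\<in>carrier R. e \<odot>\<^bsub>M\<^esub> n = n \<and> e \<odot>\<^bsub>M\<^esub> h = \<zero>\<^bsub>M\<^esub>)"

text \<open>A separating scalar \<open>e\<close> is the same as a decomposition \<open>1 = (1 - e) + e\<close> with the first
  summand in the annihilator of \<open>n\<close> and the second one in that of \<open>h\<close>. It exists if and only if the
  sum of the two annihilators is not a proper ideal.\<close>

lemma (in module) separating_scalar_iff_no_prime_above_annihilators:
  assumes n: "n \<in> carrier M" and h: "h \<in> carrier M"
  shows "(\<exists>e\<in>carrier R. e \<odot>\<^bsub>M\<^esub> n = n \<and> e \<odot>\<^bsub>M\<^esub> h = \<zero>\<^bsub>M\<^esub>) \<longleftrightarrow>
    \<not> (\<exists>P. primeideal P R \<and> annihilator R M n \<subseteq> P \<and> annihilator R M h \<subseteq> P)"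
    (is "?sep \<longleftrightarrow> \<not> ?prime")
proof
  assume ?sep
  then obtain e where e: "e \<in> carrier R" "e \<odot>\<^bsub>M\<^esub> n = n" "e \<odot>\<^bsub>M\<^esub> h = \<zero>\<^bsub>M\<^esub>"
    by blast
  have ann: "e \<in> annihilator R M h" "\<one> \<oplus> \<ominus> e \<in> annihilator R M n"
    using e n by (auto simp: annihilator_def smult_l_distr smult_l_minus M.r_neg)
  show "\<not> ?prime"
  proof
    assume ?prime
    then obtain P where P: "primeideal P R" "annihilator R M n \<subseteq> P" "annihilator R M h \<subseteq> P"
      by blast
    interpret P: primeideal P R by (rule P(1))
    have "(\<one> \<oplus> \<ominus> e) \<oplus> e \<in> P"
      using ann P by (blast intro: P.a_closed)
    moreover have "(\<one> \<oplus> \<ominus> e) \<oplus> e = \<one>"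
      using e(1) by (simp add: R.a_assoc R.l_neg)
    ultimately show False
      using P.one_imp_carrier P.I_notcarr by simp
  qed
next
  assume no_prime: "\<not> ?prime"
  let ?I = "annihilator R M n <+>\<^bsub>R\<^esub> annihilator R M h"
  have ideals: "ideal (annihilator R M n) R" "ideal (annihilator R M h) R"
    using n h by (auto intro: annihilator_ideal)
  have zeros: "\<zero> \<in> annihilator R M n" "\<zero> \<in> annihilator R M h"
    using n h by (auto simp: annihilator_def)
  have above: "annihilator R M n \<subseteq> ?I" "annihilator R M h \<subseteq> ?I"
    using zeros unfolding set_add_def'
    by (auto simp: annihilator_def intro: bexI[of _ \<zero>])
  have "\<one> \<in> ?I"
  proof (rule ccontr)
    assume "\<one> \<notin> ?I"
    then obtain P where "primeideal P R" "?I \<subseteq> P"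
      by (rule R.proper_ideal_imp_prime_above[OF R.add_ideals[OF ideals]])
    then show False
      using above no_prime by blast
  qed
  then obtain d e where de: "d \<in> annihilator R M n" "e \<in> annihilator R M h" "\<one> = d \<oplus> e"
    unfolding set_add_def' by auto
  then have "n = (d \<oplus> e) \<odot>\<^bsub>M\<^esub> n"
    using n smult_one by metis
  then have "e \<odot>\<^bsub>M\<^esub> n = n"
    using de n by (simp add: annihilator_def smult_l_distr)
  then show ?sep
    using de(2) by (auto simp: annihilator_def)
qed

lemma (in module) disjoint_Supp_iff_separated_by_scalars:
  assumes N: "submodule N R M" and H: "submodule H R M"
  shows "Supp R (M\<lparr>carrier := N\<rparr>) \<inter> Supp R (M\<lparr>carrier := H\<rparr>) = {} \<longleftrightarrow>
    separated_by_scalars R M N H"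
proof -
  have Supp: "P \<in> Supp R (M\<lparr>carrier := K\<rparr>) \<longleftrightarrow>
      primeideal P R \<and> (\<exists>k\<in>K. annihilator R M k \<subseteq> P)" if "submodule K R M" for K P
    using module.mem_Supp_iff[OF submodule.submodule_is_module[OF that module_axioms]] by simp
  have "N \<subseteq> carrier M" "H \<subseteq> carrier M"
    using N H by (auto dest: submoduleE(1))
  then have "separated_by_scalars R M N H \<longleftrightarrow> (\<forall>n\<in>N. \<forall>h\<in>H.
      \<not> (\<exists>P. primeideal P R \<and> annihilator R M n \<subseteq> P \<and> annihilator R M h \<subseteq> P))"
    unfolding separated_by_scalars_def
    by (intro ball_cong refl separating_scalar_iff_no_prime_above_annihilators) auto
  also have "\<dots> \<longleftrightarrow> Supp R (M\<lparr>carrier := N\<rparr>) \<inter> Supp R (M\<lparr>carrier := H\<rparr>) = {}"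
    by (auto simp: Supp[OF N] Supp[OF H] set_eq_iff)
  finally show ?thesis ..
qed

section \<open>Distributive direct summands\<close>

lemma set_addI:
  "x \<in> A \<Longrightarrow> y \<in> B \<Longrightarrow> z = x \<oplus>\<^bsub>G\<^esub> y \<Longrightarrow> z \<in> A <+>\<^bsub>G\<^esub> B"
  unfolding set_add_def' by auto

lemma set_addE:
  assumes "z \<in> A <+>\<^bsub>G\<^esub> B"
  obtains x y where "x \<in> A" "y \<in> B" "z = x \<oplus>\<^bsub>G\<^esub> y"
  using assms unfolding set_add_def' by auto

lemma (in module) internal_direct_sum_sym:
  assumes "internal_direct_sum R M N H"
  shows "internal_direct_sum R M H N"
proof -
  have sub: "N \<subseteq> carrier M" "H \<subseteq> carrier M"
    using assms by (auto simp: internal_direct_sum_def dest: submoduleE(1))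
  have "H <+>\<^bsub>M\<^esub> N = (\<Union>h\<in>H. \<Union>n\<in>N. {n \<oplus>\<^bsub>M\<^esub> h})"
    unfolding set_add_def'
  proof (intro SUP_cong refl)
    fix h n assume "h \<in> H" "n \<in> N"
    then have "h \<oplus>\<^bsub>M\<^esub> n = n \<oplus>\<^bsub>M\<^esub> h"
      using sub by (intro M.a_comm) auto
    then show "{h \<oplus>\<^bsub>M\<^esub> n} = {n \<oplus>\<^bsub>M\<^esub> h}"
      by (rule arg_cong)
  qed
  also have "\<dots> = N <+>\<^bsub>M\<^esub> H"
    unfolding set_add_def' by (rule SUP_commute)
  finally have "H <+>\<^bsub>M\<^esub> N = N <+>\<^bsub>M\<^esub> H" .
  moreover have "H \<inter> N = N \<inter> H"
    by (rule Int_commute)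
  ultimately show ?thesis
    using assms unfolding internal_direct_sum_def by metis
qed

lemma (in module) direct_sum_component_unique:
  assumes "internal_direct_sum R M N H"
    and n: "n \<in> N" "n' \<in> N" and h: "h \<in> H" and eq: "n \<oplus>\<^bsub>M\<^esub> h = n'"
  shows "n = n'" "h = \<zero>\<^bsub>M\<^esub>"
proof -
  have N: "submodule N R M" and H: "submodule H R M" and disj: "N \<inter> H = {\<zero>\<^bsub>M\<^esub>}"
    using assms(1) by (auto simp: internal_direct_sum_def)
  have c: "n \<in> carrier M" "n' \<in> carrier M" "h \<in> carrier M"
    using n h submoduleE(1)[OF N] submoduleE(1)[OF H] by auto
  have "h = \<ominus>\<^bsub>M\<^esub> n \<oplus>\<^bsub>M\<^esub> n'"
    using c eq by (metis M.r_neg1)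
  then have "h \<in> N"
    using n submoduleE(3,5)[OF N] by simp
  then show "h = \<zero>\<^bsub>M\<^esub>"
    using h disj by auto
  then show "n = n'"
    using eq c by simp
qed

lemma (in module) cyclic_submodule:
  assumes x: "x \<in> carrier M"
  shows "submodule ((\<lambda>a. a \<odot>\<^bsub>M\<^esub> x) ` carrier R) R M" (is "submodule ?C R M")
proof (rule submoduleI)
  show "\<zero>\<^bsub>M\<^esub> \<in> ?C"
    using x by (intro image_eqI[of _ _ \<zero>]) auto
  show "\<ominus>\<^bsub>M\<^esub> y \<in> ?C" if "y \<in> ?C" for y
    using that x by (auto simp flip: smult_l_minus)
  show "y \<oplus>\<^bsub>M\<^esub> z \<in> ?C" if "y \<in> ?C" "z \<in> ?C" for y z
    using that x by (auto simp flip: smult_l_distr)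
  show "a \<odot>\<^bsub>M\<^esub> y \<in> ?C" if "a \<in> carrier R" "y \<in> ?C" for a y
    using that x by (auto simp flip: smult_assoc1)
qed (use x in auto)

text \<open>The scalar comes from distributing \<open>N\<close> over the cyclic submodules generated by \<open>n + h\<close> and \<open>h\<close>:
  their sum contains \<open>n = (n + h) - h\<close>, but the second one meets \<open>N\<close> only in zero, so \<open>n\<close> itself is
  a multiple of \<open>n + h\<close>.\<close>

lemma (in module) distributive_imp_separated_by_scalars:
  assumes sum: "internal_direct_sum R M N H" and distr: "distributive_submodule R M N"
  shows "separated_by_scalars R M N H"
  unfolding separated_by_scalars_def
proof (intro ballI)
  fix n h assume n: "n \<in> N" and h: "h \<in> H"
  have N: "submodule N R M" and H: "submodule H R M" and disj: "N \<inter> H = {\<zero>\<^bsub>M\<^esub>}"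
    using sum by (auto simp: internal_direct_sum_def)
  have c: "n \<in> carrier M" "h \<in> carrier M"
    using n h submoduleE(1)[OF N] submoduleE(1)[OF H] by auto
  let ?Y1 = "(\<lambda>a. a \<odot>\<^bsub>M\<^esub> (n \<oplus>\<^bsub>M\<^esub> h)) ` carrier R" and ?Y2 = "(\<lambda>a. a \<odot>\<^bsub>M\<^esub> h) ` carrier R"
  have "n = \<one> \<odot>\<^bsub>M\<^esub> (n \<oplus>\<^bsub>M\<^esub> h) \<oplus>\<^bsub>M\<^esub> (\<ominus> \<one>) \<odot>\<^bsub>M\<^esub> h"
    using c by (simp add: smult_l_minus M.a_assoc M.r_neg)
  then have "n \<in> ?Y1 <+>\<^bsub>M\<^esub> ?Y2"
    by (rule set_addI[rotated 2]) (intro imageI R.one_closed R.a_inv_closed)+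
  then have "n \<in> (?Y1 <+>\<^bsub>M\<^esub> ?Y2) \<inter> N"
    using n by blast
  also have "\<dots> = (?Y1 \<inter> N) <+>\<^bsub>M\<^esub> (?Y2 \<inter> N)"
    using distr cyclic_submodule[OF M.a_closed[OF c]] cyclic_submodule[OF c(2)]
    unfolding distributive_submodule_def by blast
  finally obtain y1 y2 where y: "y1 \<in> ?Y1" "y1 \<in> N" "y2 \<in> ?Y2" "y2 \<in> N" "n = y1 \<oplus>\<^bsub>M\<^esub> y2"
    by (elim set_addE IntE)
  have "y2 \<in> H"
    using y(3) h submoduleE(4)[OF H] by auto
  then have "y2 = \<zero>\<^bsub>M\<^esub>"
    using y(4) disj by auto
  then have "y1 = n"
    using y(2,5) submoduleE(1)[OF N] by auto
  then obtain e where e: "e \<in> carrier R" "e \<odot>\<^bsub>M\<^esub> n \<oplus>\<^bsub>M\<^esub> e \<odot>\<^bsub>M\<^esub> h = n"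
    using y(1) c by (auto simp: smult_r_distr)
  have "e \<odot>\<^bsub>M\<^esub> n = n" "e \<odot>\<^bsub>M\<^esub> h = \<zero>\<^bsub>M\<^esub>"
    using direct_sum_component_unique[OF sum _ _ _ e(2)] n h e(1)
      submoduleE(4)[OF N] submoduleE(4)[OF H] by auto
  then show "\<exists>e\<in>carrier R. e \<odot>\<^bsub>M\<^esub> n = n \<and> e \<odot>\<^bsub>M\<^esub> h = \<zero>\<^bsub>M\<^esub>"
    using e(1) by blast
qed

text \<open>Separating scalars project every submodule to its intersection with \<open>N\<close>. If \<open>y\<^sub>1 + y\<^sub>2\<close> lies in
  \<open>N\<close>, it is therefore the sum of the \<open>N\<close>-components of \<open>y\<^sub>1\<close> and \<open>y\<^sub>2\<close>, which stay in the
  submodules that \<open>y\<^sub>1\<close> and \<open>y\<^sub>2\<close> come from.\<close>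

lemma (in module) separated_by_scalars_imp_distributive:
  assumes sum: "internal_direct_sum R M N H" and sep: "separated_by_scalars R M N H"
  shows "distributive_submodule R M N"
  unfolding distributive_submodule_def
proof (intro conjI allI impI)
  have N: "submodule N R M" and H: "submodule H R M" and all: "N <+>\<^bsub>M\<^esub> H = carrier M"
    using sum by (auto simp: internal_direct_sum_def)
  have Nc: "N \<subseteq> carrier M" and Hc: "H \<subseteq> carrier M"
    using N H by (auto dest: submoduleE(1))
  show "submodule N R M" by (rule N)
  \<comment> \<open>A separating scalar for \<open>n\<close> and \<open>h\<close> maps \<open>y = n + h\<close> to \<open>n\<close>.\<close>
  have split: "\<exists>n\<in>Y \<inter> N. \<exists>h\<in>H. y = n \<oplus>\<^bsub>M\<^esub> h" if Y: "submodule Y R M" and y: "y \<in> Y" for Y y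
  proof -
    have "y \<in> N <+>\<^bsub>M\<^esub> H"
      using y submoduleE(1)[OF Y] all by auto
    then obtain n h where nh: "n \<in> N" "h \<in> H" "y = n \<oplus>\<^bsub>M\<^esub> h"
      by (rule set_addE)
    then obtain e where e: "e \<in> carrier R" "e \<odot>\<^bsub>M\<^esub> n = n" "e \<odot>\<^bsub>M\<^esub> h = \<zero>\<^bsub>M\<^esub>"
      using sep unfolding separated_by_scalars_def by blast
    have "n \<in> carrier M" "h \<in> carrier M"
      using nh Nc Hc by auto
    then have "e \<odot>\<^bsub>M\<^esub> y = n"
      using nh(3) e by (simp add: smult_r_distr)
    then have "n \<in> Y"
      using submoduleE(4)[OF Y e(1) y] by simp
    then show ?thesis
      using nh by blast
  qed
  fix Y1 Y2 assume Y1: "submodule Y1 R M" and Y2: "submodule Y2 R M"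
  show "(Y1 <+>\<^bsub>M\<^esub> Y2) \<inter> N = (Y1 \<inter> N) <+>\<^bsub>M\<^esub> (Y2 \<inter> N)"
  proof
    show "(Y1 \<inter> N) <+>\<^bsub>M\<^esub> (Y2 \<inter> N) \<subseteq> (Y1 <+>\<^bsub>M\<^esub> Y2) \<inter> N"
      using submoduleE(5)[OF N] by (auto elim!: set_addE intro: set_addI)
    show "(Y1 <+>\<^bsub>M\<^esub> Y2) \<inter> N \<subseteq> (Y1 \<inter> N) <+>\<^bsub>M\<^esub> (Y2 \<inter> N)"
    proof
      fix y assume y: "y \<in> (Y1 <+>\<^bsub>M\<^esub> Y2) \<inter> N"
      then obtain y1 y2 where y12: "y1 \<in> Y1" "y2 \<in> Y2" "y = y1 \<oplus>\<^bsub>M\<^esub> y2"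
        by (elim IntE set_addE)
      obtain n1 h1 where 1: "n1 \<in> Y1 \<inter> N" "h1 \<in> H" "y1 = n1 \<oplus>\<^bsub>M\<^esub> h1"
        using split[OF Y1 y12(1)] by blast
      obtain n2 h2 where 2: "n2 \<in> Y2 \<inter> N" "h2 \<in> H" "y2 = n2 \<oplus>\<^bsub>M\<^esub> h2"
        using split[OF Y2 y12(2)] by blast
      have c: "n1 \<in> carrier M" "n2 \<in> carrier M" "h1 \<in> carrier M" "h2 \<in> carrier M"
        using 1 2 Nc Hc by auto
      have "(n1 \<oplus>\<^bsub>M\<^esub> n2) \<oplus>\<^bsub>M\<^esub> (h1 \<oplus>\<^bsub>M\<^esub> h2) = y"
        using c by (simp add: y12(3) 1(3) 2(3) M.a_ac)
      then have "n1 \<oplus>\<^bsub>M\<^esub> n2 = y"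
        using direct_sum_component_unique(1)[OF sum] 1 2 y submoduleE(5)[OF N]
          submoduleE(5)[OF H] by blast
      then show "y \<in> (Y1 \<inter> N) <+>\<^bsub>M\<^esub> (Y2 \<inter> N)"
        using 1(1) 2(1) by (blast intro: set_addI)
    qed
  qed
qed

lemma (in module) distributive_summand_iff_disjoint_Supp:
  assumes "internal_direct_sum R M N H"
  shows "distributive_submodule R M N \<longleftrightarrow>
    Supp R (M\<lparr>carrier := N\<rparr>) \<inter> Supp R (M\<lparr>carrier := H\<rparr>) = {}"
proof -
  have "distributive_submodule R M N \<longleftrightarrow> separated_by_scalars R M N H"
    using assms distributive_imp_separated_by_scalars separated_by_scalars_imp_distributive
    by blast
  then show ?thesis
    using assms disjoint_Supp_iff_separated_by_scalars by (simp add: internal_direct_sum_def)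
qed

theorem corollary3p2:
  fixes R :: "('a, 'r) ring_scheme" and M :: "('a, 'b, 'm) module_scheme"
    and N H :: "'b set"
  assumes "module R M"
    and "internal_direct_sum R M N H"
  shows "(distributive_submodule R M N \<longleftrightarrow>
            Supp R (M\<lparr>carrier := N\<rparr>) \<inter> Supp R (M\<lparr>carrier := H\<rparr>) = {}) \<and>
         (Supp R (M\<lparr>carrier := N\<rparr>) \<inter> Supp R (M\<lparr>carrier := H\<rparr>) = {} \<longleftrightarrow>
            distributive_submodule R M H)"
proof -
  interpret module R M by (rule assms(1))
  show ?thesis
    using distributive_summand_iff_disjoint_Supp[OF assms(2)]
      distributive_summand_iff_disjoint_Supp[OF internal_direct_sum_sym[OF assms(2)]]
    by (simp add: Int_commute)
qed

end
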